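(* Let $(X_1,\dots,X_N)$ be a univariate sample of size $N$ and let $(\tilde X_1,\dots,\tilde X_N)$ be the standardized sample. Then the statistic $$M_1=N\int_{S_2}\left|\frac{1}{N^2}\sum_{j,k=1}^N e^{i(a\tilde X_j+b\tilde X_k)}-e^{-\frac12}\right|^2 dS_2(a,b)$$ has the form $$M_1=2\pi N\left[\frac{1}{N^4}\sum_{p,j,k,l=1}^N J\big(d(\tilde X_p-\tilde X_k,\tilde X_j-\tilde X_l)\big)-e^{-\frac12}\,\frac{2}{N^2}\sum_{p,j=1}^N J\big(d(\tilde X_p,\tilde X_j)\big)+e^{-1}\right],$$ where $J$ is the Bessel function of order zero of the first kind, $J(z)=\sum_{k=0}^\infty(-1)^k\frac{(z^2/4)^k}{(k!)^2}$, and $d(x,y)=\sqrt{x^2+y^2}$.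
   Context: $S_2=\{(a,b)\in\mathbb{R}^2: a^2+b^2=1\}$ is the unit circle and $\int_{S_2}\cdot\,dS_2$ is the (unnormalized) surface integral over it, i.e. integration with respect to arc length, of total mass $2\pi$. In the exponent, $i$ is the imaginary unit. The standardized sample is the sequence of real numbers $\tilde X_1,\dots,\tilde X_N$ obtained from $X_1,\dots,X_N$ by subtracting the sample mean and dividing by the sample standard deviation (assumed nonzero). *)

theory Defs
  imports "HOL-Analysis.Analysis"
begin

text \<open>A sample of size \<open>N\<close> is a function \<open>X :: nat \<Rightarrow> real\<close> of which only the
  values \<open>X 1, \<dots>, X N\<close> are used.\<close>

definition sample_mean :: "nat \<Rightarrow> (nat \<Rightarrow> real) \<Rightarrow> real" where
  "sample_mean N X = (\<Sum>j=1..N. X j) / real N"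

text \<open>Both normalisations of the sample standard deviation are in use: \<open>c = 0\<close> divides the sum of
  squares by \<open>N\<close>, \<open>c = 1\<close> divides it by \<open>N - 1\<close>.\<close>

definition sample_sd :: "nat \<Rightarrow> nat \<Rightarrow> (nat \<Rightarrow> real) \<Rightarrow> real" where
  "sample_sd c N X = sqrt ((\<Sum>j=1..N. (X j - sample_mean N X)\<^sup>2) / (real N - real c))"

definition standardized :: "nat \<Rightarrow> nat \<Rightarrow> (nat \<Rightarrow> real) \<Rightarrow> nat \<Rightarrow> real" where
  "standardized c N X j = (X j - sample_mean N X) / sample_sd c N X"

definition S2 :: "(real \<times> real) set" where
  "S2 = {(a, b). a\<^sup>2 + b\<^sup>2 = 1}"

text \<open>The curve \<open>t \<mapsto> (cos t, sin t)\<close> on \<open>[0, 2\<pi>)\<close> has unit speed and runs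
  through every point of the circle exactly once, so arc length on the circle is the image of
  Lebesgue measure on \<open>[0, 2\<pi>)\<close>.\<close>

definition dS2 :: "(real \<times> real) measure" where
  "dS2 = distr (restrict_space lborel {0..<2 * pi}) (restrict_space borel S2) (\<lambda>t. (cos t, sin t))"

definition bessel_J0 :: "real \<Rightarrow> real" where
  "bessel_J0 z = (\<Sum>k. (-1) ^ k * ((z\<^sup>2 / 4) ^ k / (fact k)\<^sup>2))"

definition d :: "real \<Rightarrow> real \<Rightarrow> real" where
  "d x y = sqrt (x\<^sup>2 + y\<^sup>2)"

definition M1 :: "nat \<Rightarrow> (nat \<Rightarrow> real) \<Rightarrow> real" where
  "M1 N Y = real N * (\<integral>(a, b).
     (cmod ((1 / of_nat N ^ 2) * (\<Sum>j=1..N. \<Sum>k=1..N. exp (\<i> * of_real (a * Y j + b * Y k)))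
            - of_real (exp (- (1 / 2)))))\<^sup>2 \<partial>dS2)"

lemma circle_measurable:
  "(\<lambda>t. (cos t, sin t)) \<in> restrict_space lborel {0..<2 * pi} \<rightarrow>\<^sub>M restrict_space borel S2"
  by (rule measurable_restrict_space2)
     (auto simp: S2_def borel_prod[symmetric] intro!: measurable_restrict_space1)

lemma space_dS2: "space dS2 = S2"
  by (simp add: dS2_def space_restrict_space)

lemma emeasure_dS2_S2: "emeasure dS2 S2 = ennreal (2 * pi)"
proof -
  have "S2 \<in> sets (restrict_space borel S2)"
    using sets.top[of "restrict_space borel S2"] by (simp add: space_restrict_space)
  moreover have "(\<lambda>t. (cos t, sin t)) -` S2 \<inter> {0..<2 * pi} = {0..<2 * pi}"
    by (auto simp: S2_def)
  ultimately show ?thesis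
    unfolding dS2_def
    by (simp add: emeasure_distr[OF circle_measurable] space_restrict_space emeasure_restrict_space)
qed

lemma summable_bessel_J0: "summable (\<lambda>k. (-1) ^ k * ((z\<^sup>2 / 4) ^ k / (fact k)\<^sup>2) :: real)"
proof (rule summable_comparison_test[OF _ summable_exp[of "z\<^sup>2 / 4"]], intro exI allI impI)
  fix k :: nat
  have "(z\<^sup>2 / 4) ^ k / (fact k)\<^sup>2 \<le> (z\<^sup>2 / 4) ^ k / fact k"
    by (rule divide_left_mono) (auto simp: power2_eq_square)
  moreover have "norm ((-1) ^ k * ((z\<^sup>2 / 4) ^ k / (fact k)\<^sup>2)) = (z\<^sup>2 / 4) ^ k / (fact k)\<^sup>2"
    by (simp add: abs_mult)
  ultimately show "norm ((-1) ^ k * ((z\<^sup>2 / 4) ^ k / (fact k)\<^sup>2)) \<le> inverse (fact k) * (z\<^sup>2 / 4) ^ k"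
    by (simp only: divide_inverse mult.commute)
qed

end

theory Submission
  imports Defs
begin

text \<open>
  Write \<open>u = a x + b y\<close> for a linear form restricted to the circle. The theorem rests on the
  classical integral representation \<open>\<integral> cos u \<partial>dS2 = 2\<pi> J(d x y)\<close>: the Bessel function of order zero
  is, up to the factor \<open>2\<pi>\<close>, the Fourier transform of arc length on the circle. Everything else is algebra, because for a
  real constant \<open>c\<close> the squared modulus \<open>\<bar>1/n \<Sum> exp (i \<theta>\<^sub>s) - c\<bar>\<^sup>2\<close> is a linear combination of
  the cosines \<open>cos (\<theta>\<^sub>s - \<theta>\<^sub>t)\<close> and \<open>cos \<theta>\<^sub>s\<close> (lemma \<open>cmod_mean_exp_diff_sq\<close>), and for
  \<open>\<theta> = a Y\<^sub>j + b Y\<^sub>k\<close> each of these arguments is again a linear form in \<open>(a, b)\<close>.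

  The integral representation follows by integrating the cosine series term by term. The moments
  of \<open>u\<close> that this requires are found without rotating the circle. Along \<open>(cos t, sin t)\<close> one has
  \<open>u\<^sup>2 + u'\<^sup>2 = x\<^sup>2 + y\<^sup>2\<close> and \<open>u'' = -u\<close>, so that
  \<open>(u\<^bsup>n+1\<^esup> u')' = (n+1) (x\<^sup>2 + y\<^sup>2) u\<^sup>n - (n+2) u\<^bsup>n+2\<^esup>\<close>; the integral of the left-hand side over
  a period vanishes, and this is a recurrence from the \<open>n\<close>-th moment to the \<open>(n+2)\<close>-nd
  (lemma \<open>dS2_moment_rec\<close>).
\<close>

section \<open>Integration over the circle\<close>

lemma borel_measurable_dS2:
  fixes f :: "real \<times> real \<Rightarrow> 'b :: topological_space"
  assumes "continuous_on UNIV f"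
  shows "f \<in> borel_measurable dS2"
proof -
  have "f \<in> borel_measurable (restrict_space borel S2)"
    using assms by (intro measurable_restrict_space1 borel_measurable_continuous_onI)
  thus ?thesis by (simp add: dS2_def)
qed

lemma integral_dS2:
  fixes f :: "real \<times> real \<Rightarrow> real"
  assumes "continuous_on UNIV f"
  shows "(\<integral>z. f z \<partial>dS2) = (LBINT t=0..2 * pi. f (cos t, sin t))"
proof -
  have "f \<in> borel_measurable (restrict_space borel S2)"
    using assms by (intro measurable_restrict_space1 borel_measurable_continuous_onI)
  hence "(\<integral>z. f z \<partial>dS2) = (\<integral>t. f (cos t, sin t) \<partial>restrict_space lborel {0..<2 * pi})"
    unfolding dS2_def by (rule integral_distr[OF circle_measurable])
  also have "\<dots> = (LBINT t:{0..<2 * pi}. f (cos t, sin t))"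
    by (simp add: integral_restrict_space set_lebesgue_integral_def)
  also have "\<dots> = (LBINT t=0..2 * pi. f (cos t, sin t))"
    using interval_integral_Ico[of 0 "2 * pi" "\<lambda>t. f (cos t, sin t)"]
    by (simp add: zero_ereal_def)
  finally show ?thesis .
qed

lemma measure_dS2_space: "measure dS2 (space dS2) = 2 * pi"
  by (simp add: measure_def space_dS2 emeasure_dS2_S2)

lemma finite_measure_dS2: "finite_measure dS2"
  by (rule finite_measureI) (simp add: space_dS2 emeasure_dS2_S2)

lemma abs_coordinates_S2_le_1:
  assumes "z \<in> S2"
  shows "\<bar>fst z\<bar> \<le> 1" "\<bar>snd z\<bar> \<le> 1"
proof -
  have "(fst z)\<^sup>2 + (snd z)\<^sup>2 = 1" using assms by (auto simp: S2_def)
  moreover have "(fst z)\<^sup>2 \<ge> 0" "(snd z)\<^sup>2 \<ge> 0" by simp_all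
  ultimately have "(fst z)\<^sup>2 \<le> 1" "(snd z)\<^sup>2 \<le> 1" by linarith+
  thus "\<bar>fst z\<bar> \<le> 1" "\<bar>snd z\<bar> \<le> 1" by (simp_all add: abs_square_le_1)
qed

lemma integrable_dS2:
  fixes f :: "real \<times> real \<Rightarrow> real"
  assumes "continuous_on UNIV f"
  shows "integrable dS2 f"
proof -
  interpret finite_measure dS2 by (rule finite_measure_dS2)
  \<comment> \<open>\<open>[-1, 1]\<^sup>2\<close> is a compact set that contains the circle.\<close>
  have "compact (f ` ({-1..1} \<times> {-1..1}))"
    using assms by (intro compact_continuous_image compact_Times)
      (auto intro: continuous_on_subset)
  then obtain B where B: "\<And>z. z \<in> {-1..1} \<times> {-1..1} \<Longrightarrow> norm (f z) \<le> B"
    by (meson bounded_iff compact_imp_bounded imageI)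
  have "norm (f z) \<le> B" if "z \<in> space dS2" for z
  proof (rule B)
    show "z \<in> {-1..1} \<times> {-1..1}"
      using abs_coordinates_S2_le_1[of z] that by (auto simp: space_dS2 mem_Times_iff)
  qed
  thus ?thesis
    by (intro integrable_const_bound[where B = B] borel_measurable_dS2 assms) auto
qed

section \<open>The Bessel function as the Fourier transform of arc length\<close>

text \<open>The derivative of \<open>u\<^bsup>n+1\<^esup> u'\<close> has integral zero over a period. On the circle it agrees with
  the polynomial \<open>g\<close> in the coordinates, so that statement is one about moments.\<close>

lemma dS2_moment_rec:
  fixes x y :: real
  shows "real (n + 2) * (\<integral>z. (fst z * x + snd z * y) ^ (n + 2) \<partial>dS2) =
    real (n + 1) * (x\<^sup>2 + y\<^sup>2) * (\<integral>z. (fst z * x + snd z * y) ^ n \<partial>dS2)"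
proof -
  define u where "u = (\<lambda>t. cos t * x + sin t * y)"
  define v where "v = (\<lambda>t. - sin t * x + cos t * y)"
  define g where "g = (\<lambda>z :: real \<times> real. real (n + 1) * (x\<^sup>2 + y\<^sup>2) * (fst z * x + snd z * y) ^ n
    - real (n + 2) * (fst z * x + snd z * y) ^ (n + 2))"
  have cont: "continuous_on UNIV g" unfolding g_def by (intro continuous_intros)
  have g_circle: "g (cos t, sin t) = real (n + 1) * u t ^ n * v t * v t - u t ^ (n + 1) * u t" for t
  proof -
    have "(u t)\<^sup>2 + (v t)\<^sup>2 = ((cos t)\<^sup>2 + (sin t)\<^sup>2) * (x\<^sup>2 + y\<^sup>2)"
      unfolding u_def v_def by algebra
    hence r: "x\<^sup>2 + y\<^sup>2 = (u t)\<^sup>2 + (v t)\<^sup>2" by simp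
    have "g (cos t, sin t) = real (n + 1) * (x\<^sup>2 + y\<^sup>2) * u t ^ n - real (n + 2) * u t ^ (n + 2)"
      by (simp add: g_def u_def)
    thus ?thesis
      unfolding r by (simp add: algebra_simps power2_eq_square)
  qed
  have "((\<lambda>t. u t ^ (n + 1) * v t) has_real_derivative g (cos t, sin t)) (at t)" for t
  proof -
    have "(u has_real_derivative v t) (at t)" "(v has_real_derivative - u t) (at t)"
      unfolding u_def v_def by (auto intro!: derivative_eq_intros)
    from DERIV_mult[OF DERIV_power[OF this(1), of "n + 1"] this(2)] show ?thesis
      by (simp add: g_circle algebra_simps)
  qed
  hence "(LBINT t=0..2 * pi. g (cos t, sin t)) = u (2 * pi) ^ (n + 1) * v (2 * pi) - u 0 ^ (n + 1) * v 0"
    unfolding zero_ereal_def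
    by (intro interval_integral_FTC_finite continuous_on_compose2[OF cont] continuous_intros)
      (auto intro: has_vector_derivative_at_within
            simp: has_real_derivative_iff_has_vector_derivative)
  hence "(\<integral>z. g z \<partial>dS2) = 0"
    by (simp add: integral_dS2[OF cont] u_def v_def)
  moreover have "integrable dS2 (\<lambda>z. (fst z * x + snd z * y) ^ m)" for m
    by (intro integrable_dS2 continuous_intros)
  ultimately show ?thesis
    unfolding g_def by (simp del: power_Suc)
qed

text \<open>Starting from the total mass \<open>2\<pi>\<close>, the recurrence multiplies by \<open>(d x y)\<^sup>2 (2i-1)/(2i)\<close> for
  \<open>i = 1, \<dots>, k\<close>, and the product of these fractions is \<open>(2k)! / (4\<^sup>k (k!)\<^sup>2)\<close>. The factor \<open>(2k)!\<close> is kept apart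
  because what remains is the \<open>k\<close>-th term of the Bessel series without its sign.\<close>

lemma dS2_even_moment:
  fixes x y :: real
  shows "(\<integral>z. (fst z * x + snd z * y) ^ (2 * k) \<partial>dS2) =
    2 * pi * (fact (2 * k) * (((d x y)\<^sup>2 / 4) ^ k / (fact k)\<^sup>2))"
proof (induction k)
  case 0
  show ?case by (simp add: measure_dS2_space)
next
  case (Suc k)
  let ?F = "\<lambda>m. (\<integral>z. (fst z * x + snd z * y) ^ m \<partial>dS2)"
  have d2: "(d x y)\<^sup>2 = x\<^sup>2 + y\<^sup>2" by (simp add: d_def)
  have "?F (2 * Suc k) = real (2 * k + 1) * (d x y)\<^sup>2 / real (2 * k + 2) * ?F (2 * k)"
    using dS2_moment_rec[of "2 * k" x y] by (simp add: d2 field_simps)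
  also have "\<dots> = 2 * pi * (fact (2 * Suc k) * (((d x y)\<^sup>2 / 4) ^ Suc k / (fact (Suc k))\<^sup>2))"
    unfolding Suc.IH
    by (simp add: divide_simps power2_eq_square) (simp add: algebra_simps)
  finally show ?case .
qed

text \<open>The factor \<open>(2k)!\<close> of the \<open>2k\<close>-th moment cancels the denominator of the cosine series and
  leaves the Bessel series. The series may be integrated term by term because \<open>u\<close> is bounded by
  \<open>\<bar>x\<bar> + \<bar>y\<bar>\<close> on the circle, where the cosine series converges absolutely and uniformly.\<close>

lemma integral_dS2_cos:
  fixes x y :: real
  shows "(\<integral>z. cos (fst z * x + snd z * y) \<partial>dS2) = 2 * pi * bessel_J0 (d x y)"
proof -
  interpret finite_measure dS2 by (rule finite_measure_dS2)
  define u where "u = (\<lambda>z :: real \<times> real. fst z * x + snd z * y)"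
  define R where "R = \<bar>x\<bar> + \<bar>y\<bar>"
  define f where "f = (\<lambda>k z. (-1) ^ k / fact (2 * k) * u z ^ (2 * k))"
  have f_sums: "(\<lambda>k. f k z) sums cos (u z)" for z
    unfolding f_def by (rule cos_paired)
  have int_f: "integrable dS2 (f k)" for k
    unfolding f_def u_def by (intro integrable_dS2 continuous_intros)
  have sum_R: "summable (\<lambda>k. r ^ (2 * k) / fact (2 * k))" if "r \<ge> 0" for r :: real
  proof -
    have "summable (\<lambda>k. r ^ k / fact k)"
      using summable_exp[of r] by (simp add: divide_inverse mult.commute)
    from summable_reindex[OF this, of "\<lambda>k. 2 * k"] that show ?thesis
      by (simp add: o_def inj_def)
  qed
  have norm_f: "norm (f k z) = \<bar>u z\<bar> ^ (2 * k) / fact (2 * k)" for k z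
    by (simp add: f_def abs_mult power_abs)
  have f_le: "norm (f k z) \<le> R ^ (2 * k) / fact (2 * k)" if "z \<in> space dS2" for k z
  proof -
    have "\<bar>fst z\<bar> * \<bar>x\<bar> + \<bar>snd z\<bar> * \<bar>y\<bar> \<le> 1 * \<bar>x\<bar> + 1 * \<bar>y\<bar>"
      using abs_coordinates_S2_le_1[of z] that
      by (intro add_mono mult_right_mono) (auto simp: space_dS2)
    hence "\<bar>u z\<bar> \<le> R"
      unfolding u_def R_def using abs_triangle_ineq[of "fst z * x" "snd z * y"]
      by (simp add: abs_mult)
    thus ?thesis unfolding norm_f by (intro divide_right_mono power_mono) auto
  qed
  have "(\<lambda>k. \<integral>z. f k z \<partial>dS2) sums (\<integral>z. (\<Sum>k. f k z) \<partial>dS2)"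
  proof (rule sums_integral[OF int_f])
    show "AE z in dS2. summable (\<lambda>k. norm (f k z))"
      unfolding norm_f by (simp add: sum_R)
    have "norm (\<integral>z. norm (f k z) \<partial>dS2) \<le> 2 * pi * (R ^ (2 * k) / fact (2 * k))" for k
    proof -
      have "(\<integral>z. norm (f k z) \<partial>dS2) \<le> (\<integral>z. R ^ (2 * k) / fact (2 * k) \<partial>dS2)"
        using f_le by (intro integral_mono integrable_norm int_f) auto
      thus ?thesis by (simp add: measure_dS2_space abs_of_nonneg)
    qed
    moreover have "summable (\<lambda>k. 2 * pi * (R ^ (2 * k) / fact (2 * k)))"
      by (intro summable_mult sum_R) (simp add: R_def)
    ultimately show "summable (\<lambda>k. \<integral>z. norm (f k z) \<partial>dS2)"
      by (rule summable_comparison_test'[where N = 0, rotated])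
  qed
  moreover have "(\<integral>z. f k z \<partial>dS2) = 2 * pi * ((-1) ^ k * (((d x y)\<^sup>2 / 4) ^ k / (fact k)\<^sup>2))" for k
    unfolding f_def u_def using dS2_even_moment[of x y k] by simp
  ultimately have "(\<lambda>k. 2 * pi * ((-1) ^ k * (((d x y)\<^sup>2 / 4) ^ k / (fact k)\<^sup>2))) sums
      (\<integral>z. cos (u z) \<partial>dS2)"
    using f_sums by (simp add: sums_iff)
  moreover have "(\<lambda>k. 2 * pi * ((-1) ^ k * (((d x y)\<^sup>2 / 4) ^ k / (fact k)\<^sup>2))) sums
      (2 * pi * bessel_J0 (d x y))"
    unfolding bessel_J0_def by (intro sums_mult summable_sums summable_bessel_J0)
  ultimately show ?thesis
    unfolding u_def by (rule sums_unique2)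
qed

section \<open>The empirical characteristic function on the circle\<close>

text \<open>Real and imaginary part contribute \<open>(1/n \<Sum> cos \<theta>\<^sub>s - c)\<^sup>2 + (1/n \<Sum> sin \<theta>\<^sub>s)\<^sup>2\<close>: the product sums
  of the cosines and of the sines merge by the subtraction formula, and the cross term with the
  real number \<open>c\<close> sees only the cosines.\<close>

lemma cmod_mean_exp_diff_sq:
  fixes \<theta> :: "'a \<Rightarrow> real" and n c :: real
  shows "(cmod ((1 / of_real n) * (\<Sum>s\<in>S. exp (\<i> * of_real (\<theta> s))) - of_real c))\<^sup>2 =
    1 / n\<^sup>2 * (\<Sum>s\<in>S. \<Sum>t\<in>S. cos (\<theta> s - \<theta> t)) - c * (2 / n) * (\<Sum>s\<in>S. cos (\<theta> s)) + c\<^sup>2"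
proof -
  define C where "C = (\<Sum>s\<in>S. cos (\<theta> s))"
  define D where "D = (\<Sum>s\<in>S. sin (\<theta> s))"
  have "(\<Sum>s\<in>S. exp (\<i> * of_real (\<theta> s))) = Complex C D"
    by (simp add: C_def D_def complex_eq_iff Re_exp Im_exp)
  hence "(1 / of_real n) * (\<Sum>s\<in>S. exp (\<i> * of_real (\<theta> s))) - of_real c = Complex (C / n - c) (D / n)"
    by (simp add: complex_eq_iff Re_divide_of_real Im_divide_of_real)
  hence "(cmod ((1 / of_real n) * (\<Sum>s\<in>S. exp (\<i> * of_real (\<theta> s))) - of_real c))\<^sup>2
      = (C / n - c)\<^sup>2 + (D / n)\<^sup>2"
    by (simp add: cmod_power2)
  also have "\<dots> = 1 / n\<^sup>2 * (C * C + D * D) - c * (2 / n) * C + c\<^sup>2"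
    by (simp add: power2_eq_square algebra_simps add_divide_distrib)
  also have "C * C + D * D = (\<Sum>s\<in>S. \<Sum>t\<in>S. cos (\<theta> s - \<theta> t))"
    by (simp add: C_def D_def sum_product cos_diff sum.distrib)
  finally show ?thesis by (simp add: C_def)
qed

theorem proposition4p1:
  fixes N c :: nat and X Y :: "nat \<Rightarrow> real"
  assumes "N \<ge> 1"
    and "c \<in> {0, 1}"
    and "sample_sd c N X \<noteq> 0"
    and "Y = standardized c N X"
  shows "M1 N Y = 2 * pi * real N *
    (1 / real N ^ 4 * (\<Sum>p=1..N. \<Sum>j=1..N. \<Sum>k=1..N. \<Sum>l=1..N. bessel_J0 (d (Y p - Y k) (Y j - Y l)))
     - exp (- (1 / 2)) * (2 / real N ^ 2) * (\<Sum>p=1..N. \<Sum>j=1..N. bessel_J0 (d (Y p) (Y j)))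
     + exp (- 1))"
proof -
  define e :: real where "e = exp (- (1 / 2))"
  have e2: "e\<^sup>2 = exp (- 1)" by (simp add: e_def flip: exp_double)
  \<comment> \<open>Pairs of indices are treated as a single summation index: the double sum of exponentials is
    then one sum over \<open>I\<close>, and its square yields the fourfold sum.\<close>
  define I where "I = {1..N} \<times> {1..N}"
  define \<theta> where "\<theta> = (\<lambda>z s. fst z * Y (fst s) + snd z * Y (snd s))"
  have integrand: "(cmod ((1 / of_nat N ^ 2) *
        (\<Sum>j=1..N. \<Sum>k=1..N. exp (\<i> * of_real (a * Y j + b * Y k))) - of_real e))\<^sup>2 =
      1 / real N ^ 4 * (\<Sum>s\<in>I. \<Sum>t\<in>I. cos (a * (Y (fst s) - Y (fst t)) + b * (Y (snd s) - Y (snd t))))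
      - e * (2 / real N ^ 2) * (\<Sum>s\<in>I. cos (a * Y (fst s) + b * Y (snd s))) + e\<^sup>2" for a b
  proof -
    have "(\<Sum>j=1..N. \<Sum>k=1..N. exp (\<i> * of_real (a * Y j + b * Y k))) =
        (\<Sum>s\<in>I. exp (\<i> * of_real (\<theta> (a, b) s)))"
      by (simp add: I_def \<theta>_def sum.cartesian_product case_prod_beta)
    moreover have "\<theta> (a, b) s - \<theta> (a, b) t =
        a * (Y (fst s) - Y (fst t)) + b * (Y (snd s) - Y (snd t))" for s t
      by (simp add: \<theta>_def algebra_simps)
    ultimately show ?thesis
      using cmod_mean_exp_diff_sq[of "real N ^ 2" "\<theta> (a, b)" I e]
      by (simp add: \<theta>_def flip: power_mult)
  qed
  define A where "A = (\<lambda>z. \<Sum>s\<in>I. \<Sum>t\<in>I.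
    cos (fst z * (Y (fst s) - Y (fst t)) + snd z * (Y (snd s) - Y (snd t))))"
  define B where "B = (\<lambda>z. \<Sum>s\<in>I. cos (fst z * Y (fst s) + snd z * Y (snd s)))"
  have int_cos: "integrable dS2 (\<lambda>z. cos (fst z * x + snd z * y))" for x y
    by (intro integrable_dS2 continuous_intros)
  have int: "integrable dS2 A" "integrable dS2 B" "integrable dS2 (\<lambda>z. e\<^sup>2)"
    unfolding A_def B_def by (intro integrable_dS2 continuous_intros)+
  have "M1 N Y = real N * (\<integral>z. 1 / real N ^ 4 * A z - e * (2 / real N ^ 2) * B z + e\<^sup>2 \<partial>dS2)"
    unfolding M1_def e_def[symmetric] integrand by (simp add: A_def B_def case_prod_unfold)
  also have "\<dots> = real N * (1 / real N ^ 4 * (\<integral>z. A z \<partial>dS2)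
      - e * (2 / real N ^ 2) * (\<integral>z. B z \<partial>dS2) + 2 * pi * e\<^sup>2)"
    using int by (simp add: measure_dS2_space)
  also have "(\<integral>z. A z \<partial>dS2) =
      2 * pi * (\<Sum>s\<in>I. \<Sum>t\<in>I. bessel_J0 (d (Y (fst s) - Y (fst t)) (Y (snd s) - Y (snd t))))"
    unfolding A_def
    by (simp add: Bochner_Integration.integral_sum int_cos integral_dS2_cos sum_distrib_left)
  also have "(\<integral>z. B z \<partial>dS2) = 2 * pi * (\<Sum>s\<in>I. bessel_J0 (d (Y (fst s)) (Y (snd s))))"
    unfolding B_def
    by (simp add: Bochner_Integration.integral_sum int_cos integral_dS2_cos sum_distrib_left)
  finally have "M1 N Y = 2 * pi * real N * (1 / real N ^ 4 *
        (\<Sum>s\<in>I. \<Sum>t\<in>I. bessel_J0 (d (Y (fst s) - Y (fst t)) (Y (snd s) - Y (snd t))))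
      - e * (2 / real N ^ 2) * (\<Sum>s\<in>I. bessel_J0 (d (Y (fst s)) (Y (snd s)))) + e\<^sup>2)"
    by (simp add: algebra_simps)
  thus ?thesis
    unfolding I_def sum.cartesian_product' e2 by (simp add: e_def)
qed

end
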